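(* Let $N\ge 1$, let $\mathbf A,\mathbf B_1,\mathbf B_2,\mathbf D$ be complex $N\times N$ matrices, let $L\in\mathbb C\setminus\{0\}$ and $k_x\in\mathbb C$ with $1-ik_xL/2\neq 0$, and let $\mathbf u_0\in\mathbb C^N$ satisfy the dispersion relation $$\left(-k_x^2\mathbf A+ik_x(\mathbf B_1+\mathbf B_2)+\mathbf D\right)\mathbf u_0=\mathbf 0 .$$ Let $\mathbf K_{11},\mathbf K_{12},\mathbf K_{21},\mathbf K_{22}$ be the blocks of the stiffness matrix of the midpoint-integrated linear finite element of length $L$, and let $\mathbf K_{HS}$ be the half-space stiffness, both as defined in the context. Put $$P=\frac{1+ik_xL/2}{1-ik_xL/2},\qquad \mathbf u_L=P\,\mathbf u_0 .$$ Then: (i) (fixed-point property) $$\begin{bmatrix}\mathbf K_{11}&\mathbf K_{12}\\ \mathbf K_{21}&\mathbf K_{22}+\mathbf K_{HS}\end{bmatrix}\begin{Bmatrix}\mathbf u_0\\ \mathbf u_L\end{Bmatrix}=\begin{Bmatrix}\mathbf K_{HS}\mathbf u_0\\ \mathbf 0\end{Bmatrix};$$ (ii) (propagation of tractions) if $\mathbf F_0,\mathbf F_L\in\mathbb C^N$ are defined by $$\begin{Bmatrix}\mathbf F_0\\ -\mathbf F_L\end{Bmatrix}=\begin{bmatrix}\mathbf K_{11}&\mathbf K_{12}\\ \mathbf K_{21}&\mathbf K_{22}\end{bmatrix}\begin{Bmatrix}\mathbf u_0\\ \mathbf u_L\end{Bmatrix},$$ then $$\mathbf F_0=-(ik_x\mathbf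 A+\mathbf B_1)\mathbf u_0,\qquad \mathbf F_L=-P\,(ik_x\mathbf A+\mathbf B_1)\mathbf u_0=P\,\mathbf F_0 .$$
   Context: The setting is the (semi-discretized in $z$) time-harmonic elastodynamic equation in $x$, $$\frac{\partial}{\partial x}\left(\mathbf A\frac{\partial\mathbf u}{\partial x}\right)+\frac{\partial}{\partial x}(\mathbf B_1\mathbf u)+\mathbf B_2\frac{\partial\mathbf u}{\partial x}+\mathbf D\mathbf u=\mathbf 0,$$ with $\mathbf A,\mathbf B_1,\mathbf B_2,\mathbf D$ of size $N\times N$ and independent of $x$, which has modes $\mathbf u=\boldsymbol\phi e^{ik_xx}$ with $(-k_x^2\mathbf A+ik_x(\mathbf B_1+\mathbf B_2)+\mathbf D)\boldsymbol\phi=\mathbf 0$. The traction is $\mathbf F=-(\mathbf A\,\partial\mathbf u/\partial x+\mathbf B_1\mathbf u)$, and the (exact) stiffness of the right half-space for the mode with wavenumber $k_x$ is $$\mathbf K_{HS}=-(ik_x\mathbf A+\mathbf B_1).$$ The stiffness matrix of one linear finite element of (possibly complex) length $L$, with all integrals evaluated by the midpoint rule, is $$\begin{bmatrix}\mathbf K_{11}&\mathbf K_{12}\\ \mathbf K_{21}&\mathbf K_{22}\end{bmatrix}=\frac1L\begin{bmatrix}\mathbf A&-\mathbf A\\-\mathbf A&\mathbf A\end{bmatrix}+\frac12\begin{bmatrix}-\mathbf B_1&-\mathbf B_1\\ \mathbf B_1&\mathbf B_1\end{bmatrix}-\frac12\begin{bmatrix}-\mathbf B_2&\mathbf B_2\\-\mathbf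 B_2&\mathbf B_2\end{bmatrix}-\frac L4\begin{bmatrix}\mathbf D&\mathbf D\\ \mathbf D&\mathbf D\end{bmatrix}.$$ *)

theory Defs
  imports Complex_Main "Jordan_Normal_Form.Matrix"
begin

(* Weak form of (A u' + B1 u)' + B2 u' + D u = 0 after integration by parts,
     integral over the element of  v' (A u' + B1 u) - v (B2 u' + D u),
   with linear shape functions and every integral replaced by L times the
   integrand at the midpoint, where both shape functions equal 1/2 and their
   derivatives are -1/L and 1/L. *)
definition midpoint_fe_stiffness ::
  "complex mat \<Rightarrow> complex mat \<Rightarrow> complex mat \<Rightarrow> complex mat \<Rightarrow> complex \<Rightarrow> complex mat" where
  "midpoint_fe_stiffness A B1 B2 D L =
     (1 / L) \<cdot>\<^sub>m four_block_mat A (- A) (- A) A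
     + (1 / 2) \<cdot>\<^sub>m four_block_mat (- B1) (- B1) B1 B1
     - (1 / 2) \<cdot>\<^sub>m four_block_mat (- B2) B2 (- B2) B2
     - (L / 4) \<cdot>\<^sub>m four_block_mat D D D D"

definition half_space_stiffness ::
  "complex mat \<Rightarrow> complex mat \<Rightarrow> complex \<Rightarrow> complex mat" where
  "half_space_stiffness A B1 kx = - ((\<i> * kx) \<cdot>\<^sub>m A + B1)"

end

theory Submission
  imports Defs
begin

text \<open>On multiples of a fixed vector a linear element acts through two numbers, the difference
quotient \<open>(P - 1) / L\<close> and the midpoint average \<open>(1 + P) / 2\<close> of the nodal values
\<open>1, P\<close>.  With \<open>q = \<i> k\<^sub>x L / 2\<close>, the ratio \<open>P = (1 + q) / (1 - q)\<close> makes them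
\<open>\<i> k\<^sub>x / (1 - q)\<close> and \<open>1 / (1 - q)\<close> (\<open>nodal_mean_and_difference\<close>): up to a common
factor, the midpoint rule sees the derivative and the value of the exact mode.

Put \<open>Z = \<i> k\<^sub>x A + B\<^sub>1\<close>.  The part \<open>v' (A u' + B\<^sub>1 u)\<close> of the weak form contributes
\<open>- Z u\<^sub>0 / (1 - q)\<close> to the left row and \<open>Z u\<^sub>0 / (1 - q)\<close> to the right one.  The dispersion
relation says \<open>(\<i> k\<^sub>x B\<^sub>2 + D) u\<^sub>0 = - \<i> k\<^sub>x Z u\<^sub>0\<close>, so the part
\<open>- v (B\<^sub>2 u' + D u)\<close>, where \<open>v\<close> enters with weight \<open>L / 2\<close>, contributes
\<open>q Z u\<^sub>0 / (1 - q)\<close> to both.  The rows are therefore \<open>- Z u\<^sub>0\<close> and \<open>P Z u\<^sub>0\<close>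
(\<open>element_tractions\<close>).  Read as nodal forces they are the tractions of the theorem; and since
the half-space stiffness is \<open>- Z\<close>, the left row is its product with \<open>u\<^sub>0\<close>, while
attaching the half-space at the right node adds \<open>- P Z u\<^sub>0\<close> and cancels the right row.\<close>

lemma split_midpoint_fe_stiffness:
  assumes "A \<in> carrier_mat N N" "B1 \<in> carrier_mat N N"
    and "B2 \<in> carrier_mat N N" "D \<in> carrier_mat N N"
  shows "split_block (midpoint_fe_stiffness A B1 B2 D L) N N =
    ((1 / L) \<cdot>\<^sub>m A - (1 / 2) \<cdot>\<^sub>m B1 + (1 / 2) \<cdot>\<^sub>m B2 - (L / 4) \<cdot>\<^sub>m D,
     - ((1 / L) \<cdot>\<^sub>m A) - (1 / 2) \<cdot>\<^sub>m B1 - (1 / 2) \<cdot>\<^sub>m B2 - (L / 4) \<cdot>\<^sub>m D,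
     - ((1 / L) \<cdot>\<^sub>m A) + (1 / 2) \<cdot>\<^sub>m B1 + (1 / 2) \<cdot>\<^sub>m B2 - (L / 4) \<cdot>\<^sub>m D,
     (1 / L) \<cdot>\<^sub>m A + (1 / 2) \<cdot>\<^sub>m B1 - (1 / 2) \<cdot>\<^sub>m B2 - (L / 4) \<cdot>\<^sub>m D)"
  using assms
  by (auto simp: split_block_def midpoint_fe_stiffness_def Let_def intro!: eq_matI)

text \<open>With \<open>q = \<i> k\<^sub>x L / 2\<close> the two equations give \<open>(P - 1) / L = \<i> k\<^sub>x (1 + P) / 2\<close>:
at the midpoint the linear interpolant has exactly the logarithmic derivative of the mode.\<close>
text \<open>With \<open>q = \<i> k\<^sub>x L / 2\<close> the two equations give \<open>(P - 1) / L = \<i> k\<^sub>x (1 + P) / 2\<close>: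
at the midpoint the linear interpolant has exactly the logarithmic derivative of the mode.\<close>
lemma nodal_mean_and_difference:
  fixes q P :: complex
  assumes "1 - q \<noteq> 0" and "P = (1 + q) / (1 - q)"
  shows "1 + P = 2 / (1 - q)" and "1 - P = - 2 * q / (1 - q)"
  using assms by (simp_all add: field_simps)

text \<open>The row products are linear in the products of \<open>A, B\<^sub>1, B\<^sub>2, D\<close> with \<open>u\<^sub>0\<close>,
so it suffices to treat the \<open>i\<close>-th components \<open>a, b1, b2, d\<close> of those four vectors.\<close>
lemma element_tractions:
  fixes a b1 b2 d :: complex
  assumes L: "L \<noteq> 0" and kx: "1 - \<i> * kx * L / 2 \<noteq> 0"
    and P: "P = (1 + \<i> * kx * L / 2) / (1 - \<i> * kx * L / 2)"
    and dispersion: "- (kx\<^sup>2) * a + \<i> * kx * (b1 + b2) + d = 0"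
  shows "(1 / L * a - 1 / 2 * b1 + 1 / 2 * b2 - L / 4 * d)
      + P * (- (1 / L * a) - 1 / 2 * b1 - 1 / 2 * b2 - L / 4 * d) = - (\<i> * kx * a + b1)"
    and "(- (1 / L * a) + 1 / 2 * b1 + 1 / 2 * b2 - L / 4 * d)
      + P * (1 / L * a + 1 / 2 * b1 - 1 / 2 * b2 - L / 4 * d) = P * (\<i> * kx * a + b1)"
proof -
  define q where "q = \<i> * kx * L / 2"
  have q: "1 - q \<noteq> 0" and Pq: "P = (1 + q) / (1 - q)" using kx P by (auto simp: q_def)
  note PP = nodal_mean_and_difference[OF q Pq]
  have d: "d = - (\<i> * kx) * (\<i> * kx * a + b1) - \<i> * kx * b2"
    using dispersion by (simp add: algebra_simps power2_eq_square add_eq_0_iff)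
  have "(1 / L * a - 1 / 2 * b1 + 1 / 2 * b2 - L / 4 * d)
      + P * (- (1 / L * a) - 1 / 2 * b1 - 1 / 2 * b2 - L / 4 * d)
      = (1 - P) * (a / L + b2 / 2) - (1 + P) * (b1 / 2 + L / 4 * d)"
    by (simp add: algebra_simps diff_divide_distrib add_divide_distrib)
  also have "\<dots> = - (2 * q * (a / L + b2 / 2) + 2 * (b1 / 2 + L / 4 * d)) / (1 - q)"
    unfolding PP by (simp add: diff_divide_distrib add_divide_distrib)
  also have "2 * q * (a / L + b2 / 2) + 2 * (b1 / 2 + L / 4 * d) = (1 - q) * (\<i> * kx * a + b1)"
    unfolding d q_def using L by (simp add: field_simps)
  finally show "(1 / L * a - 1 / 2 * b1 + 1 / 2 * b2 - L / 4 * d)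
      + P * (- (1 / L * a) - 1 / 2 * b1 - 1 / 2 * b2 - L / 4 * d) = - (\<i> * kx * a + b1)"
    using q by simp
  have "(- (1 / L * a) + 1 / 2 * b1 + 1 / 2 * b2 - L / 4 * d)
      + P * (1 / L * a + 1 / 2 * b1 - 1 / 2 * b2 - L / 4 * d)
      = (1 - P) * (- a / L + b2 / 2) + (1 + P) * (b1 / 2 - L / 4 * d)"
    by (simp add: algebra_simps diff_divide_distrib add_divide_distrib)
  also have "\<dots> = (- (2 * q * (- a / L + b2 / 2)) + 2 * (b1 / 2 - L / 4 * d)) / (1 - q)"
    unfolding PP by (simp add: diff_divide_distrib add_divide_distrib)
  also have "- (2 * q * (- a / L + b2 / 2)) + 2 * (b1 / 2 - L / 4 * d) = (1 + q) * (\<i> * kx * a + b1)"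
    unfolding d q_def using L by (simp add: field_simps)
  finally show "(- (1 / L * a) + 1 / 2 * b1 + 1 / 2 * b2 - L / 4 * d)
      + P * (1 / L * a + 1 / 2 * b1 - 1 / 2 * b2 - L / 4 * d) = P * (\<i> * kx * a + b1)"
    by (simp add: Pq)
qed

lemma smult_mult_mat_vec:
  fixes A :: "'a :: comm_ring mat"
  assumes "A \<in> carrier_mat nr nc" "v \<in> carrier_vec nc"
  shows "(k \<cdot>\<^sub>m A) *\<^sub>v v = k \<cdot>\<^sub>v (A *\<^sub>v v)"
  using assms by (intro eq_vecI) (auto simp: scalar_prod_def sum_distrib_left mult.assoc)

theorem mainTheorem1:
  fixes N :: nat
    and A B1 B2 D K11 K12 K21 K22 K_HS :: "complex mat"
    and L kx P :: complex
    and u0 uL :: "complex vec"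
  assumes N: "N \<ge> 1"
    and A: "A \<in> carrier_mat N N"
    and B1: "B1 \<in> carrier_mat N N"
    and B2: "B2 \<in> carrier_mat N N"
    and D: "D \<in> carrier_mat N N"
    and L: "L \<noteq> 0"
    and kx: "1 - \<i> * kx * L / 2 \<noteq> 0"
    and u0: "u0 \<in> carrier_vec N"
    and dispersion:
      "((- (kx\<^sup>2)) \<cdot>\<^sub>m A + (\<i> * kx) \<cdot>\<^sub>m (B1 + B2) + D) *\<^sub>v u0 = 0\<^sub>v N"
    and K: "(K11, K12, K21, K22) = split_block (midpoint_fe_stiffness A B1 B2 D L) N N"
    and K_HS: "K_HS = half_space_stiffness A B1 kx"
    and P: "P = (1 + \<i> * kx * L / 2) / (1 - \<i> * kx * L / 2)"
    and uL: "uL = P \<cdot>\<^sub>v u0"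
  shows "four_block_mat K11 K12 K21 (K22 + K_HS) *\<^sub>v (u0 @\<^sub>v uL)
           = (K_HS *\<^sub>v u0) @\<^sub>v 0\<^sub>v N
         \<and> (\<forall>F0 \<in> carrier_vec N. \<forall>FL \<in> carrier_vec N.
              F0 @\<^sub>v (- FL) = four_block_mat K11 K12 K21 K22 *\<^sub>v (u0 @\<^sub>v uL) \<longrightarrow>
                F0 = - (((\<i> * kx) \<cdot>\<^sub>m A + B1) *\<^sub>v u0) \<and>
                FL = - (P \<cdot>\<^sub>v (((\<i> * kx) \<cdot>\<^sub>m A + B1) *\<^sub>v u0)) \<and>
                FL = P \<cdot>\<^sub>v F0)"
proof -
  define Z where "Z = (\<i> * kx) \<cdot>\<^sub>m A + B1"
  have Z: "Z \<in> carrier_mat N N" using A B1 by (simp add: Z_def)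
  note blocks = K[unfolded split_midpoint_fe_stiffness[OF A B1 B2 D] prod.inject]
  have car: "K11 \<in> carrier_mat N N" "K12 \<in> carrier_mat N N"
      "K21 \<in> carrier_mat N N" "K22 \<in> carrier_mat N N"
    using blocks A B1 B2 D by auto
  have K_HS_Z: "K_HS = - Z" by (simp add: K_HS half_space_stiffness_def Z_def)
  have uLc: "uL \<in> carrier_vec N" using uL u0 by simp
  note [simp] = A B1 B2 D u0 Z
  note [simp] = A[THEN carrier_matD(1)] A[THEN carrier_matD(2)] B1[THEN carrier_matD(1)]
    B1[THEN carrier_matD(2)] B2[THEN carrier_matD(1)] B2[THEN carrier_matD(2)]
    D[THEN carrier_matD(1)] D[THEN carrier_matD(2)] Z[THEN carrier_matD(1)]
    Z[THEN carrier_matD(2)] u0[THEN carrier_vecD]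
  note distrib = add_mult_distrib_mat_vec[where nr = N and nc = N]
    minus_mult_distrib_mat_vec[where nr = N and nc = N] smult_mult_mat_vec[where nr = N and nc = N]
    minus_carrier_mat[where nr = N and nc = N]
  \<comment> \<open>In the componentwise steps the products with \<open>u\<^sub>0\<close> must stay atomic, to match
    \<open>element_tractions\<close>; hence the deletion of \<open>index_mult_mat_vec\<close>.\<close>
  have disp: "- (kx\<^sup>2) * (A *\<^sub>v u0) $ i + \<i> * kx * ((B1 *\<^sub>v u0) $ i + (B2 *\<^sub>v u0) $ i)
      + (D *\<^sub>v u0) $ i = 0" if "i < N" for i
    using arg_cong[OF dispersion, of "\<lambda>v. v $ i"] that
    by (simp add: distrib del: index_mult_mat_vec)
  note comp = element_tractions[OF L kx P disp]
  have uL': "M *\<^sub>v uL = P \<cdot>\<^sub>v (M *\<^sub>v u0)" if "M \<in> carrier_mat N N" for M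
    using mult_mat_vec[OF that u0] by (simp add: uL)
  have left: "K11 *\<^sub>v u0 + K12 *\<^sub>v uL = - (Z *\<^sub>v u0)"
  proof (rule eq_vecI)
    fix i assume "i < dim_vec (- (Z *\<^sub>v u0))"
    then have i: "i < N" by simp
    show "(K11 *\<^sub>v u0 + K12 *\<^sub>v uL) $ i = (- (Z *\<^sub>v u0)) $ i"
      using comp(1)[OF i] i
      by (simp add: uL' blocks Z_def distrib del: index_mult_mat_vec)
  qed (use car in auto)
  have right: "K21 *\<^sub>v u0 + K22 *\<^sub>v uL = P \<cdot>\<^sub>v (Z *\<^sub>v u0)"
  proof (rule eq_vecI)
    fix i assume "i < dim_vec (P \<cdot>\<^sub>v (Z *\<^sub>v u0))"
    then have i: "i < N" by simp
    show "(K21 *\<^sub>v u0 + K22 *\<^sub>v uL) $ i = (P \<cdot>\<^sub>v (Z *\<^sub>v u0)) $ i"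
      using comp(2)[OF i] i
      by (simp add: uL' blocks Z_def distrib del: index_mult_mat_vec)
  qed (use car in auto)
  have rows: "four_block_mat K11 K12 K21 K22 *\<^sub>v (u0 @\<^sub>v uL)
      = - (Z *\<^sub>v u0) @\<^sub>v P \<cdot>\<^sub>v (Z *\<^sub>v u0)"
    using four_block_mat_mult_vec[OF car u0 uLc] by (simp add: left right)
  have sum0: "K21 *\<^sub>v u0 + (K22 + K_HS) *\<^sub>v uL = 0\<^sub>v N"
  proof -
    have "(K22 + K_HS) *\<^sub>v uL = K22 *\<^sub>v uL + - (P \<cdot>\<^sub>v (Z *\<^sub>v u0))"
      using add_mult_distrib_mat_vec[OF car(4) _ uLc, of K_HS] uLc uL'[OF Z]
      by (simp add: K_HS_Z)
    then have "K21 *\<^sub>v u0 + (K22 + K_HS) *\<^sub>v uL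
        = (K21 *\<^sub>v u0 + K22 *\<^sub>v uL) + - (P \<cdot>\<^sub>v (Z *\<^sub>v u0))"
      using assoc_add_vec[of "K21 *\<^sub>v u0" N "K22 *\<^sub>v uL" "- (P \<cdot>\<^sub>v (Z *\<^sub>v u0))"] car uLc
        mult_mat_vec_carrier[OF Z u0] by simp
    then show ?thesis unfolding right by (intro eq_vecI) auto
  qed
  have fixed_point: "four_block_mat K11 K12 K21 (K22 + K_HS) *\<^sub>v (u0 @\<^sub>v uL)
      = (K_HS *\<^sub>v u0) @\<^sub>v 0\<^sub>v N"
    using four_block_mat_mult_vec[OF car(1-3) _ u0 uLc, of "K22 + K_HS"] car(4)
    by (simp add: left sum0[unfolded K_HS_Z] K_HS_Z)
  have tractions: "F0 = - (Z *\<^sub>v u0) \<and> FL = - (P \<cdot>\<^sub>v (Z *\<^sub>v u0)) \<and> FL = P \<cdot>\<^sub>v F0"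
    if F: "F0 \<in> carrier_vec N" "FL \<in> carrier_vec N"
      and eq: "F0 @\<^sub>v (- FL) = four_block_mat K11 K12 K21 K22 *\<^sub>v (u0 @\<^sub>v uL)" for F0 FL
  proof -
    have "F0 = - (Z *\<^sub>v u0)" and "- FL = P \<cdot>\<^sub>v (Z *\<^sub>v u0)"
      using eq[unfolded rows] append_vec_eq[OF F(1), of "- (Z *\<^sub>v u0)"]
        mult_mat_vec_carrier[OF Z u0] by simp_all
    moreover from this(2) have "FL = - (P \<cdot>\<^sub>v (Z *\<^sub>v u0))"
      by (metis uminus_uminus_vec)
    moreover have "P \<cdot>\<^sub>v (- (Z *\<^sub>v u0)) = - (P \<cdot>\<^sub>v (Z *\<^sub>v u0))"
      by (intro eq_vecI) auto
    ultimately show ?thesis by simp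
  qed
  show ?thesis
    using fixed_point tractions unfolding Z_def by blast
qed

end
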